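(* For every constant $c$ there exist $n$ and a node $\Gamma_n$ of covtree with $k=|\Gamma_n|$ such that $\Gamma_n$ has no witness of size at most $n+k+c$.
   Context: Posets are finite; an unlabelled poset is an isomorphism class. A downset of $Q$ is a subset closed downward. $D_n(Q)$ denotes the set of downsets of $Q$ of size $n$ up to isomorphism. For a set $\Gamma_n$ of distinct unlabelled posets each of size $n$, a poset $Q$ is a witness of $\Gamma_n$ if $D_n(Q)=\Gamma_n$. A node of covtree (at level $n$) is a set $\Gamma_n$ of unlabelled posets of size $n$ that has at least one witness. *)

theory Defs
  imports Complex_Main
begin

text \<open>A (labelled) finite poset, represented on natural-number labels:
  a carrier set together with its order relation (as a set of pairs).
  Every finite poset is isomorphic to one of this form.\<close>
type_synonym lposet = "nat set \<times> (nat \<times> nat) set"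

definition is_poset :: "lposet \<Rightarrow> bool" where
  "is_poset P \<longleftrightarrow> finite (fst P) \<and> snd P \<subseteq> fst P \<times> fst P
     \<and> (\<forall>x\<in>fst P. (x, x) \<in> snd P) \<and> antisym (snd P) \<and> trans (snd P)"

definition poset_iso :: "lposet \<Rightarrow> lposet \<Rightarrow> bool" where
  "poset_iso P Q \<longleftrightarrow> (\<exists>f. bij_betw f (fst P) (fst Q) \<and>
     (\<forall>x\<in>fst P. \<forall>y\<in>fst P. (x, y) \<in> snd P \<longleftrightarrow> (f x, f y) \<in> snd Q))"

text \<open>An unlabelled poset = isomorphism class of a poset.\<close>
definition iso_class :: "lposet \<Rightarrow> lposet set" where
  "iso_class P = {P'. is_poset P' \<and> poset_iso P' P}"

definition unlabelled_poset_of_size :: "nat \<Rightarrow> lposet set \<Rightarrow> bool" where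
  "unlabelled_poset_of_size n X \<longleftrightarrow> (\<exists>P. is_poset P \<and> card (fst P) = n \<and> X = iso_class P)"

definition is_downset :: "lposet \<Rightarrow> nat set \<Rightarrow> bool" where
  "is_downset Q S \<longleftrightarrow> S \<subseteq> fst Q \<and> (\<forall>y\<in>S. \<forall>x\<in>fst Q. (x, y) \<in> snd Q \<longrightarrow> x \<in> S)"

definition restrict_poset :: "lposet \<Rightarrow> nat set \<Rightarrow> lposet" where
  "restrict_poset Q S = (S, snd Q \<inter> (S \<times> S))"

definition Dn :: "nat \<Rightarrow> lposet \<Rightarrow> lposet set set" where
  "Dn n Q = {iso_class (restrict_poset Q S) | S. is_downset Q S \<and> card S = n}"

definition is_witness :: "nat \<Rightarrow> lposet set set \<Rightarrow> lposet \<Rightarrow> bool" where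
  "is_witness n \<Gamma> Q \<longleftrightarrow> is_poset Q \<and> Dn n Q = \<Gamma>"

definition covtree_node :: "nat \<Rightarrow> lposet set set \<Rightarrow> bool" where
  "covtree_node n \<Gamma> \<longleftrightarrow> (\<forall>X\<in>\<Gamma>. unlabelled_poset_of_size n X) \<and> (\<exists>Q. is_witness n \<Gamma> Q)"

end

theory Submission
  imports Defs "HOL-Combinatorics.Transposition"
begin

text \<open>
  Let \<open>Q\<^sub>N\<close> be the disjoint union of an \<open>N\<close>-chain and a fork (an \<open>(N-2)\<close>-chain
  topped by two incomparable maximal elements), and let \<open>n = N + 1\<close>. A downset of size
  \<open>N + 1\<close> consists of \<open>a\<close> elements of the chain and \<open>N + 1 - a\<close> of the fork; exchanging
  the two maximal elements, and for \<open>2 \<le> a < N\<close> exchanging the two components, shows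
  that \<open>k \<le> N/2 + O(1)\<close>.

  A witness \<open>Q\<close> of \<open>D\<^sub>n(Q\<^sub>N)\<close> contains a downset \<open>L\<close> that is an \<open>N\<close>-chain and a
  downset \<open>W\<close> that is an \<open>N\<close>-element fork, both with least elements. If they met, their
  least elements would coincide, and adding a minimal element of \<open>W - L\<close> to \<open>L\<close> would give
  a downset of size \<open>N + 1\<close> with a least element; but every such downset of \<open>Q\<^sub>N\<close> meets
  both components. Hence \<open>|Q| \<ge> 2N\<close>, which exceeds \<open>n + k + c\<close> once \<open>N\<close> is large.
\<close>

section \<open>Downsets and isomorphism types\<close>

lemma restrict_poset_simps [simp]:
  "fst (restrict_poset Q S) = S" "snd (restrict_poset Q S) = snd Q \<inter> S \<times> S"
  by (simp_all add: restrict_poset_def)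

lemma is_poset_iff_partial_order_on:
  "is_poset P \<longleftrightarrow> finite (fst P) \<and> partial_order_on (fst P) (snd P)"
  unfolding is_poset_def partial_order_on_def preorder_on_def refl_on_def by blast

lemma is_poset_restrict:
  assumes "is_poset Q" "S \<subseteq> fst Q"
  shows "is_poset (restrict_poset Q S)"
  using assms finite_subset unfolding is_poset_def antisym_def trans_def by auto

lemma is_downsetD:
  assumes "is_downset Q S"
  shows "S \<subseteq> fst Q" "y \<in> S \<Longrightarrow> x \<in> fst Q \<Longrightarrow> (x, y) \<in> snd Q \<Longrightarrow> x \<in> S"
  using assms unfolding is_downset_def by blast+

lemma poset_iso_refl: "poset_iso P P"
  unfolding poset_iso_def by (rule exI[of _ id]) auto

lemma poset_iso_sym:
  assumes "poset_iso P Q"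
  shows "poset_iso Q P"
proof -
  obtain f where f: "bij_betw f (fst P) (fst Q)"
    and ord: "\<forall>x\<in>fst P. \<forall>y\<in>fst P. (x, y) \<in> snd P \<longleftrightarrow> (f x, f y) \<in> snd Q"
    using assms unfolding poset_iso_def by blast
  let ?g = "inv_into (fst P) f"
  have "\<forall>x\<in>fst Q. \<forall>y\<in>fst Q. (x, y) \<in> snd Q \<longleftrightarrow> (?g x, ?g y) \<in> snd P"
  proof (intro ballI)
    fix x y
    assume "x \<in> fst Q" "y \<in> fst Q"
    then have "?g x \<in> fst P" "?g y \<in> fst P" "f (?g x) = x" "f (?g y) = y"
      using f by (auto simp: bij_betw_def inv_into_into f_inv_into_f)
    then show "(x, y) \<in> snd Q \<longleftrightarrow> (?g x, ?g y) \<in> snd P"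
      using ord by metis
  qed
  then show ?thesis
    using bij_betw_inv_into[OF f] unfolding poset_iso_def by blast
qed

lemma poset_iso_trans:
  assumes "poset_iso P Q" "poset_iso Q R"
  shows "poset_iso P R"
proof -
  obtain f where f: "bij_betw f (fst P) (fst Q)"
    and ord_f: "\<forall>x\<in>fst P. \<forall>y\<in>fst P. (x, y) \<in> snd P \<longleftrightarrow> (f x, f y) \<in> snd Q"
    using assms(1) unfolding poset_iso_def by blast
  obtain g where g: "bij_betw g (fst Q) (fst R)"
    and ord_g: "\<forall>x\<in>fst Q. \<forall>y\<in>fst Q. (x, y) \<in> snd Q \<longleftrightarrow> (g x, g y) \<in> snd R"
    using assms(2) unfolding poset_iso_def by blast
  have "\<forall>x\<in>fst P. \<forall>y\<in>fst P. (x, y) \<in> snd P \<longleftrightarrow> ((g \<circ> f) x, (g \<circ> f) y) \<in> snd R"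
    using ord_f ord_g bij_betwE[OF f] by simp
  then show ?thesis
    using bij_betw_trans[OF f g] unfolding poset_iso_def by blast
qed

lemma iso_class_eqI: "poset_iso A B \<Longrightarrow> iso_class A = iso_class B"
  unfolding iso_class_def using poset_iso_trans poset_iso_sym by blast

lemma poset_iso_if_iso_class_eq:
  assumes "is_poset A" "iso_class A = iso_class B"
  shows "poset_iso A B"
  using assms poset_iso_refl unfolding iso_class_def by blast

lemma iso_class_restrict_image:
  assumes "inj_on f S" "\<forall>p\<in>S. \<forall>q\<in>S. (p, q) \<in> snd Q \<longleftrightarrow> (f p, f q) \<in> snd Q"
  shows "iso_class (restrict_poset Q S) = iso_class (restrict_poset Q (f ` S))"
proof (rule iso_class_eqI)
  have "bij_betw f S (f ` S)"
    using assms(1) by (simp add: bij_betw_def)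
  then show "poset_iso (restrict_poset Q S) (restrict_poset Q (f ` S))"
    unfolding poset_iso_def using assms(2) by auto
qed

lemma covtree_node_Dn:
  assumes "is_poset Q"
  shows "covtree_node n (Dn n Q)"
proof -
  have "unlabelled_poset_of_size n (iso_class (restrict_poset Q S))"
    if "is_downset Q S" "card S = n" for S
    unfolding unlabelled_poset_of_size_def
  proof (intro exI conjI)
    show "is_poset (restrict_poset Q S)"
      using is_poset_restrict[OF assms is_downsetD(1)[OF that(1)]] .
  qed (use that in simp_all)
  then have "\<forall>X\<in>Dn n Q. unlabelled_poset_of_size n X"
    unfolding Dn_def by blast
  moreover have "is_witness n (Dn n Q) Q"
    using assms by (simp add: is_witness_def)
  ultimately show ?thesis
    unfolding covtree_node_def by blast
qed

lemma Dn_eq_embeds_downset: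
  assumes "is_poset P" "Dn n Q = Dn n P" "is_downset P T" "card T = n"
  obtains g where "inj_on g T" "is_downset Q (g ` T)"
    "\<forall>p\<in>T. \<forall>q\<in>T. (p, q) \<in> snd P \<longleftrightarrow> (g p, g q) \<in> snd Q"
proof -
  have "iso_class (restrict_poset P T) \<in> Dn n Q"
    using assms(2-4) unfolding Dn_def by blast
  then obtain S where S: "is_downset Q S"
    and cls: "iso_class (restrict_poset P T) = iso_class (restrict_poset Q S)"
    unfolding Dn_def by auto
  have "is_poset (restrict_poset P T)"
    using is_poset_restrict[OF assms(1) is_downsetD(1)[OF assms(3)]] .
  then obtain g where g: "bij_betw g T S"
    and ord: "\<forall>x\<in>T. \<forall>y\<in>T. (x, y) \<in> snd P \<inter> T \<times> T \<longleftrightarrow> (g x, g y) \<in> snd Q \<inter> S \<times> S"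
    using poset_iso_if_iso_class_eq[OF _ cls] unfolding poset_iso_def by auto
  show thesis
  proof
    show "inj_on g T" "is_downset Q (g ` T)"
      using g S by (simp_all add: bij_betw_def)
    show "\<forall>p\<in>T. \<forall>q\<in>T. (p, q) \<in> snd P \<longleftrightarrow> (g p, g q) \<in> snd Q"
      using ord bij_betwE[OF g] by blast
  qed
qed

lemma is_downset_image_embedding:
  assumes "is_downset Q (g ` T)" "T \<subseteq> fst P"
    and ord: "\<forall>p\<in>T. \<forall>q\<in>T. (p, q) \<in> snd P \<longleftrightarrow> (g p, g q) \<in> snd Q"
    and "is_downset P A" "A \<subseteq> T"
  shows "is_downset Q (g ` A)"
  unfolding is_downset_def
proof (intro conjI ballI impI)
  show "g ` A \<subseteq> fst Q"
    using assms(1,5) unfolding is_downset_def by blast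
  fix y x
  assume y: "y \<in> g ` A" and x: "x \<in> fst Q" "(x, y) \<in> snd Q"
  then obtain i where i: "i \<in> A" "y = g i"
    by blast
  have "x \<in> g ` T"
    using assms(1,5) x i unfolding is_downset_def by blast
  then obtain j where j: "j \<in> T" "x = g j"
    by blast
  then have "(j, i) \<in> snd P"
    using ord i x assms(5) by blast
  then have "j \<in> A"
    using assms(2,4) i j unfolding is_downset_def by blast
  then show "x \<in> g ` A"
    using j by blast
qed

lemma is_downset_image_automorphism:
  assumes "is_poset P" "bij_betw f (fst P) (fst P)"
    and "\<forall>p\<in>fst P. \<forall>q\<in>fst P. (p, q) \<in> snd P \<longleftrightarrow> (f p, f q) \<in> snd P"
    and "is_downset P S"
  shows "is_downset P (f ` S)"
proof (rule is_downset_image_embedding)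
  show "is_downset P (f ` fst P)"
    using assms(1,2) unfolding is_poset_def is_downset_def bij_betw_def by blast
  show "S \<subseteq> fst P"
    using is_downsetD(1)[OF assms(4)] .
qed (use assms in auto)

lemma poset_has_minimal:
  assumes "is_poset Q" "A \<subseteq> fst Q" "A \<noteq> {}"
  obtains y where "y \<in> A" "\<And>z. z \<in> A \<Longrightarrow> (z, y) \<in> snd Q \<Longrightarrow> z = y"
proof -
  have "finite (snd Q)"
    using assms(1) unfolding is_poset_def by (meson finite_SigmaI finite_subset)
  moreover have "partial_order_on (fst Q) (snd Q)"
    using assms(1) by (simp add: is_poset_iff_partial_order_on)
  ultimately have "wf (snd Q - Id)"
    by (rule partial_order_on_well_order_on)
  then obtain y where "y \<in> A" "\<And>z. (z, y) \<in> snd Q - Id \<Longrightarrow> z \<notin> A"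
    using assms(3) by (rule wfE_min') blast
  then show thesis
    using that by blast
qed

lemma least_elements_of_meeting_downsets:
  assumes "is_poset Q" "is_downset Q L" "is_downset Q W" "L \<inter> W \<noteq> {}"
    and "l \<in> L" "\<forall>x\<in>L. (l, x) \<in> snd Q"
    and "w \<in> W" "\<forall>x\<in>W. (w, x) \<in> snd Q"
  shows "l = w"
proof -
  obtain u where "u \<in> L" "u \<in> W"
    using assms(4) by blast
  then have "l \<in> W"
    using assms(2,5,6) is_downsetD[OF assms(3)] is_downsetD(1)[OF assms(2)] by blast
  then have "w \<in> L"
    using assms(5,7,8) is_downsetD[OF assms(2)] is_downsetD(1)[OF assms(3)] by blast
  with \<open>l \<in> W\<close> have "(l, w) \<in> snd Q" "(w, l) \<in> snd Q"
    using assms(6,8) by auto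
  then show "l = w"
    using assms(1) unfolding is_poset_def antisym_def by blast
qed

lemma downset_insert_minimal:
  assumes "is_poset Q" "is_downset Q L" "is_downset Q W" "\<not> W \<subseteq> L"
  obtains y where "y \<in> W" "y \<notin> L" "is_downset Q (insert y L)"
proof -
  have "W - L \<subseteq> fst Q" "W - L \<noteq> {}"
    using assms(4) is_downsetD(1)[OF assms(3)] by auto
  then obtain y where y: "y \<in> W" "y \<notin> L"
    and min: "\<And>z. z \<in> W - L \<Longrightarrow> (z, y) \<in> snd Q \<Longrightarrow> z = y"
    using poset_has_minimal[OF assms(1)] by (metis DiffE)
  have "x \<in> insert y L" if "x \<in> fst Q" "(x, y) \<in> snd Q" for x
    using that min is_downsetD(2)[OF assms(3) y(1)] by blast
  then have "is_downset Q (insert y L)"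
    using assms(2) y(1) is_downsetD(1)[OF assms(3)] unfolding is_downset_def by blast
  with y that show thesis by blast
qed

lemma downsets_with_least_disjoint:
  assumes Q: "is_poset Q" and L: "is_downset Q L" and W: "is_downset Q W" and "\<not> W \<subseteq> L"
    and l: "l \<in> L" "\<forall>x\<in>L. (l, x) \<in> snd Q" and w: "w \<in> W" "\<forall>x\<in>W. (w, x) \<in> snd Q"
    and no_least: "\<And>T m. is_downset Q T \<Longrightarrow> card T = card L + 1 \<Longrightarrow> m \<in> T
      \<Longrightarrow> \<not> (\<forall>x\<in>T. (m, x) \<in> snd Q)"
  shows "L \<inter> W = {}"
proof (rule ccontr)
  assume "L \<inter> W \<noteq> {}"
  then have "l = w"
    using least_elements_of_meeting_downsets[OF Q L W _ l w] by blast
  obtain y where y: "y \<in> W" "y \<notin> L" and T: "is_downset Q (insert y L)"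
    using downset_insert_minimal[OF Q L W \<open>\<not> W \<subseteq> L\<close>] .
  have "finite L"
    using Q is_downsetD(1)[OF L] finite_subset unfolding is_poset_def by blast
  then have "card (insert y L) = card L + 1"
    using y(2) by simp
  moreover have "\<forall>x\<in>insert y L. (l, x) \<in> snd Q"
    using l(2) w(2) y(1) \<open>l = w\<close> by blast
  ultimately show False
    using no_least[OF T] l(1) by blast
qed

section \<open>A chain beside a fork\<close>

text \<open>The chain \<open>0 < \<dots> < N - 1\<close> beside the fork \<open>N < \<dots> < 2N - 3 < 2N - 2, 2N - 1\<close>,
  whose two maximal elements are incomparable.\<close>

definition chain_fork_rel :: "nat \<Rightarrow> (nat \<times> nat) set" where
  "chain_fork_rel N =
     {(p, q). q < 2 * N \<and> p \<le> q \<and> (p < N \<longleftrightarrow> q < N) \<and> (p, q) \<noteq> (2 * N - 2, 2 * N - 1)}"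

definition chain_fork :: "nat \<Rightarrow> lposet" where
  "chain_fork N = ({..<2 * N}, chain_fork_rel N)"

lemma chain_fork_simps [simp]:
  "fst (chain_fork N) = {..<2 * N}" "snd (chain_fork N) = chain_fork_rel N"
  by (simp_all add: chain_fork_def)

lemma mem_chain_fork_rel:
  "(p, q) \<in> chain_fork_rel N \<longleftrightarrow>
     q < 2 * N \<and> p \<le> q \<and> (p < N \<longleftrightarrow> q < N) \<and> (p, q) \<noteq> (2 * N - 2, 2 * N - 1)"
  by (simp add: chain_fork_rel_def)

lemma chain_fork_rel_below_top:
  assumes "p < 2 * N - 1" "q < 2 * N - 1"
  shows "(p, q) \<in> chain_fork_rel N \<longleftrightarrow> p \<le> q \<and> (p < N \<longleftrightarrow> q < N)"
  using assms by (auto simp: mem_chain_fork_rel)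

lemma is_poset_chain_fork: "is_poset (chain_fork N)"
  unfolding is_poset_def antisym_def trans_def by (auto simp: mem_chain_fork_rel)

definition split_downset :: "nat \<Rightarrow> nat \<Rightarrow> nat set" where
  "split_downset N a = {..<a} \<union> {N..<2 * N + 1 - a}"

lemma is_downset_split_downset:
  assumes "1 \<le> a" "a \<le> N"
  shows "is_downset (chain_fork N) (split_downset N a)"
  using assms unfolding is_downset_def split_downset_def by (auto simp: mem_chain_fork_rel)

lemma card_split_downset:
  assumes "a \<le> N"
  shows "card (split_downset N a) = N + 1"
  using assms unfolding split_downset_def by (subst card_Un_disjoint) auto

lemma is_downset_chain_fork_halves:
  "is_downset (chain_fork N) {..<N}" "is_downset (chain_fork N) {N..<2 * N}"
  unfolding is_downset_def by (auto simp: mem_chain_fork_rel)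

lemma interval_if_downclosed:
  fixes B :: "nat set"
  assumes "finite B" "B \<subseteq> {N..}" "\<And>i j. i \<in> B \<Longrightarrow> N \<le> j \<Longrightarrow> j \<le> i \<Longrightarrow> j \<in> B"
  shows "\<exists>b. B = {N..<N + b}"
proof (cases "B = {}")
  case True
  then show ?thesis
    by (metis add_0_right atLeastLessThan_empty order_refl)
next
  case False
  define M where "M = Max B"
  have M: "M \<in> B"
    using assms(1) False unfolding M_def by simp
  have "B = {N..<Suc M}"
  proof
    show "B \<subseteq> {N..<Suc M}"
      using assms(1,2) unfolding M_def by (auto simp: less_Suc_eq_le)
    show "{N..<Suc M} \<subseteq> B"
      using assms(3)[OF M] by auto
  qed
  moreover have "N \<le> M"
    using M assms(2) by auto
  ultimately show ?thesis
    by (metis le_add_diff_inverse Suc_diff_le le_SucI)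
qed

lemma chain_part_of_downset:
  assumes "is_downset (chain_fork N) S"
  obtains a where "a \<le> N" "S \<inter> {..<N} = {..<a}"
proof -
  have closed: "j \<in> S \<inter> {..<N}" if "i \<in> S \<inter> {..<N}" "0 \<le> j" "j \<le> i" for i j
  proof -
    have "(j, i) \<in> chain_fork_rel N" "j < 2 * N"
      using that by (auto simp: mem_chain_fork_rel)
    then show ?thesis
      using that is_downsetD(2)[OF assms] by auto
  qed
  have "\<exists>a. S \<inter> {..<N} = {0..<0 + a}"
    by (rule interval_if_downclosed) (use closed in blast)+
  then obtain a where "S \<inter> {..<N} = {..<a}"
    by (auto simp: atLeast0LessThan)
  moreover from this have "a \<le> N"
    by (metis Int_lower2 lessThan_subset_iff)
  ultimately show thesis
    using that by blast
qed

lemma downset_chain_fork_below_top: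
  assumes S: "is_downset (chain_fork N) S" "card S = N + 1" "2 * N - 1 \<notin> S"
  obtains a where "2 \<le> a" "a \<le> N" "S = split_downset N a"
proof -
  have S_sub: "S \<subseteq> {..<2 * N - 1}"
  proof
    fix x
    assume "x \<in> S"
    then have "x < 2 * N" "x \<noteq> 2 * N - 1"
      using is_downsetD(1)[OF S(1)] S(3) by auto
    then show "x \<in> {..<2 * N - 1}"
      by simp
  qed
  obtain a where "a \<le> N" and A: "S \<inter> {..<N} = {..<a}"
    using chain_part_of_downset[OF S(1)] .
  have fork_sub: "S \<inter> {N..} \<subseteq> {N..<2 * N - 1}"
    using S_sub by auto
  have fin: "finite (S \<inter> {N..})"
    using fork_sub finite_subset by blast
  have closed: "j \<in> S \<inter> {N..}" if "i \<in> S \<inter> {N..}" "N \<le> j" "j \<le> i" for i j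
  proof -
    have "i < 2 * N - 1"
      using that(1) S_sub by auto
    then have "(j, i) \<in> chain_fork_rel N" "j < 2 * N"
      using that chain_fork_rel_below_top by auto
    then show ?thesis
      using that is_downsetD(2)[OF S(1)] by auto
  qed
  have "\<exists>b. S \<inter> {N..} = {N..<N + b}"
    by (rule interval_if_downclosed) (use fin closed in blast)+
  then obtain b where B: "S \<inter> {N..} = {N..<N + b}"
    by blast
  have "b \<le> N - 1"
    using fork_sub unfolding B by (cases "b = 0") auto
  have "S = S \<inter> {..<N} \<union> S \<inter> {N..}"
    by auto
  then have "S = {..<a} \<union> {N..<N + b}"
    unfolding A B .
  then have "card S = a + b"
    using \<open>a \<le> N\<close> by (simp, subst card_Un_disjoint) auto
  then have "a + b = N + 1"
    using S(2) by simp
  then have "2 \<le> a" "N + b = 2 * N + 1 - a"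
    using \<open>b \<le> N - 1\<close> \<open>a \<le> N\<close> by auto
  then show thesis
    using that \<open>a \<le> N\<close> \<open>S = {..<a} \<union> {N..<N + b}\<close> unfolding split_downset_def by simp
qed

lemma downset_chain_fork_with_top:
  assumes S: "is_downset (chain_fork N) S" "card S = N + 1" "2 * N - 2 \<in> S" "2 * N - 1 \<in> S"
    and "2 \<le> N"
  shows "S = split_downset N 1"
proof -
  have "j \<in> S" if "N \<le> j" "j < 2 * N" for j
  proof (cases "j = 2 * N - 2")
    case False
    with that \<open>2 \<le> N\<close> have "(j, 2 * N - 1) \<in> chain_fork_rel N"
      by (auto simp: mem_chain_fork_rel)
    then show ?thesis
      using is_downsetD(2)[OF S(1) S(4), of j] that by simp
  qed (use S(3) in simp)
  then have fork: "S \<inter> {N..} = {N..<2 * N}"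
    using is_downsetD(1)[OF S(1)] by auto
  obtain a where "a \<le> N" and A: "S \<inter> {..<N} = {..<a}"
    using chain_part_of_downset[OF S(1)] .
  have "S = S \<inter> {..<N} \<union> S \<inter> {N..}"
    by auto
  then have S_eq: "S = {..<a} \<union> {N..<2 * N}"
    unfolding A fork .
  then have "card S = a + N"
    using \<open>a \<le> N\<close> by (simp, subst card_Un_disjoint) auto
  then have "a = 1"
    using S(2) by simp
  then show ?thesis
    using S_eq unfolding split_downset_def by simp
qed

lemma chain_fork_rel_transpose_top:
  assumes "2 \<le> N" "p < 2 * N" "q < 2 * N"
  shows "(transpose (2 * N - 2) (2 * N - 1) p, transpose (2 * N - 2) (2 * N - 1) q) \<in> chain_fork_rel N
    \<longleftrightarrow> (p, q) \<in> chain_fork_rel N"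
  using assms by (auto simp: mem_chain_fork_rel transpose_def)

lemma bij_betw_transpose_top:
  "bij_betw (transpose (2 * N - 2) (2 * N - 1)) {..<2 * N} {..<2 * (N :: nat)}"
  by (rule bij_betw_transpose_iff) auto

lemma Dn_chain_fork_split_downset:
  assumes "2 \<le> N" "X \<in> Dn (N + 1) (chain_fork N)"
  obtains a where "1 \<le> a" "a \<le> N"
    "X = iso_class (restrict_poset (chain_fork N) (split_downset N a))"
proof -
  obtain S where S: "is_downset (chain_fork N) S" "card S = N + 1"
    and X: "X = iso_class (restrict_poset (chain_fork N) S)"
    using assms(2) unfolding Dn_def by blast
  show thesis
  proof (cases "2 * N - 1 \<in> S")
    case False
    then show thesis
      using downset_chain_fork_below_top[OF S False] that X by (metis le_trans one_le_numeral)
  next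
    case top: True
    show thesis
    proof (cases "2 * N - 2 \<in> S")
      case True
      then show thesis
        using downset_chain_fork_with_top[OF S True top assms(1)] that[of 1] X assms(1) by simp
    next
      case False
      let ?\<tau> = "transpose (2 * N - 2) (2 * N - 1)"
      have ord: "\<forall>p\<in>{..<2 * N}. \<forall>q\<in>{..<2 * N}.
          (p, q) \<in> chain_fork_rel N \<longleftrightarrow> (?\<tau> p, ?\<tau> q) \<in> chain_fork_rel N"
        using chain_fork_rel_transpose_top[OF assms(1)] by simp
      have S_sub: "S \<subseteq> {..<2 * N}"
        using is_downsetD(1)[OF S(1)] by simp
      have "is_downset (chain_fork N) (?\<tau> ` S)"
        using is_downset_image_automorphism[OF is_poset_chain_fork _ _ S(1)]
          bij_betw_transpose_top ord by simp
      moreover have "card (?\<tau> ` S) = N + 1"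
        using S(2) by (simp add: card_image)
      moreover have "2 * N - 1 \<notin> ?\<tau> ` S"
        using False assms(1) by (auto simp: transpose_def split: if_splits)
      moreover have "X = iso_class (restrict_poset (chain_fork N) (?\<tau> ` S))"
        unfolding X using ord S_sub by (intro iso_class_restrict_image) auto
      ultimately show thesis
        using downset_chain_fork_below_top that by (metis le_trans one_le_numeral)
    qed
  qed
qed

definition swap_halves :: "nat \<Rightarrow> nat \<Rightarrow> nat" where
  "swap_halves N p = (if p < N then p + N else p - N)"

text \<open>Exchanging the two components is not an automorphism, but it is an isomorphism between
  downsets that avoid the top \<open>2N - 1\<close> of the fork, which is the case for \<open>2 \<le> a < N\<close>.\<close>

lemma iso_class_split_downset_swap:
  assumes "2 \<le> a" "a < N"
  shows "iso_class (restrict_poset (chain_fork N) (split_downset N a))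
       = iso_class (restrict_poset (chain_fork N) (split_downset N (N + 1 - a)))"
proof -
  have "swap_halves N ` split_downset N a = split_downset N (N + 1 - a)"
  proof
    show "swap_halves N ` split_downset N a \<subseteq> split_downset N (N + 1 - a)"
      using assms unfolding split_downset_def swap_halves_def by auto
    show "split_downset N (N + 1 - a) \<subseteq> swap_halves N ` split_downset N a"
    proof
      fix q
      assume "q \<in> split_downset N (N + 1 - a)"
      then have "swap_halves N (swap_halves N q) = q" "swap_halves N q \<in> split_downset N a"
        using assms unfolding split_downset_def swap_halves_def by auto
      then show "q \<in> swap_halves N ` split_downset N a"
        by (metis image_eqI)
    qed
  qed
  moreover have "inj_on (swap_halves N) (split_downset N a)"
    using assms unfolding inj_on_def split_downset_def swap_halves_def by auto
  moreover have "(p, q) \<in> chain_fork_rel N \<longleftrightarrow> (swap_halves N p, swap_halves N q) \<in> chain_fork_rel N"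
    if "p \<in> split_downset N a" "q \<in> split_downset N a" for p q
  proof -
    have below: "p < 2 * N - 1" "q < 2 * N - 1"
      "swap_halves N p < 2 * N - 1" "swap_halves N q < 2 * N - 1"
      using that assms unfolding split_downset_def swap_halves_def by auto
    have "p \<le> q \<and> (p < N \<longleftrightarrow> q < N) \<longleftrightarrow>
        swap_halves N p \<le> swap_halves N q \<and> (swap_halves N p < N \<longleftrightarrow> swap_halves N q < N)"
      using below unfolding swap_halves_def by auto
    then show ?thesis
      using chain_fork_rel_below_top[OF below(1,2)] chain_fork_rel_below_top[OF below(3,4)] by blast
  qed
  ultimately show ?thesis
    using iso_class_restrict_image[of "swap_halves N" "split_downset N a" "chain_fork N"] by simp
qed

lemma card_Dn_chain_fork:
  assumes "2 \<le> N"
  shows "card (Dn (N + 1) (chain_fork N)) \<le> (N + 1) div 2 + 1"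
proof -
  let ?cls = "\<lambda>a. iso_class (restrict_poset (chain_fork N) (split_downset N a))"
  have "Dn (N + 1) (chain_fork N) \<subseteq> ?cls ` (insert N {1..(N + 1) div 2})"
  proof
    fix X
    assume "X \<in> Dn (N + 1) (chain_fork N)"
    then obtain a where a: "1 \<le> a" "a \<le> N" and X: "X = ?cls a"
      using Dn_chain_fork_split_downset[OF assms] by blast
    show "X \<in> ?cls ` (insert N {1..(N + 1) div 2})"
    proof (cases "a \<le> (N + 1) div 2 \<or> a = N")
      case False
      then have "X = ?cls (N + 1 - a)" "N + 1 - a \<in> {1..(N + 1) div 2}"
        using X a iso_class_split_downset_swap[of a N] by auto
      then show ?thesis
        by blast
    qed (use X a in auto)
  qed
  then have "card (Dn (N + 1) (chain_fork N)) \<le> card (?cls ` (insert N {1..(N + 1) div 2}))"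
    by (intro card_mono) auto
  also have "\<dots> \<le> card (insert N {1..(N + 1) div 2})"
    by (rule card_image_le) simp
  also have "\<dots> \<le> (N + 1) div 2 + 1"
    by (simp add: card_insert_if)
  finally show ?thesis .
qed

lemma chain_fork_no_least:
  assumes "T \<subseteq> {..<2 * N}" "card T = N + 1"
  shows "\<not> (\<forall>x\<in>T. (m, x) \<in> chain_fork_rel N)"
proof
  assume least: "\<forall>x\<in>T. (m, x) \<in> chain_fork_rel N"
  have "\<not> T \<subseteq> {N..<2 * N}" "\<not> T \<subseteq> {..<N}"
    using assms(2) card_mono[of "{N..<2 * N}" T] card_mono[of "{..<N}" T] by auto
  then obtain p q where "p \<in> T" "p < N" "q \<in> T" "N \<le> q"
    using assms(1) by force
  then have "(m, p) \<in> chain_fork_rel N" "(m, q) \<in> chain_fork_rel N"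
    using least by blast+
  with \<open>p < N\<close> \<open>N \<le> q\<close> show False
    by (auto simp: mem_chain_fork_rel)
qed

lemma witness_chain_fork_no_least_downset:
  assumes "is_poset Q" "Dn (N + 1) Q = Dn (N + 1) (chain_fork N)"
    and "is_downset Q T" "card T = N + 1" "m \<in> T"
  shows "\<not> (\<forall>x\<in>T. (m, x) \<in> snd Q)"
proof
  assume least: "\<forall>x\<in>T. (m, x) \<in> snd Q"
  obtain f where f: "inj_on f T" "is_downset (chain_fork N) (f ` T)"
    and ord: "\<forall>p\<in>T. \<forall>q\<in>T. (p, q) \<in> snd Q \<longleftrightarrow> (f p, f q) \<in> chain_fork_rel N"
    using Dn_eq_embeds_downset[OF assms(1) assms(2)[symmetric] assms(3,4)] by auto
  have "f ` T \<subseteq> {..<2 * N}" "card (f ` T) = N + 1"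
    using is_downsetD(1)[OF f(2)] card_image[OF f(1)] assms(4) by auto
  moreover have "\<forall>x\<in>f ` T. (f m, x) \<in> chain_fork_rel N"
    using least ord assms(5) by blast
  ultimately show False
    using chain_fork_no_least by blast
qed

lemma witness_chain_fork_chain_downset:
  assumes Q: "is_poset Q" and eq: "Dn (N + 1) Q = Dn (N + 1) (chain_fork N)" and "1 \<le> N"
  obtains L l where "is_downset Q L" "card L = N" "l \<in> L" "\<forall>x\<in>L. (l, x) \<in> snd Q"
    "\<forall>x\<in>L. \<forall>y\<in>L. (x, y) \<in> snd Q \<or> (y, x) \<in> snd Q"
proof -
  obtain g where g: "inj_on g (split_downset N N)" "is_downset Q (g ` split_downset N N)"
    and ord: "\<forall>p\<in>split_downset N N. \<forall>q\<in>split_downset N N.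
      (p, q) \<in> chain_fork_rel N \<longleftrightarrow> (g p, g q) \<in> snd Q"
    using Dn_eq_embeds_downset[OF is_poset_chain_fork eq is_downset_split_downset[of N N]
        card_split_downset[of N N]] assms(3) by auto
  have chain_sub: "{..<N} \<subseteq> split_downset N N"
    unfolding split_downset_def by auto
  have mono: "(g i, g j) \<in> snd Q" if "i \<le> j" "j < N" for i j
  proof -
    have "(i, j) \<in> chain_fork_rel N"
      using that by (auto simp: mem_chain_fork_rel)
    moreover have "i \<in> split_downset N N" "j \<in> split_downset N N"
      using chain_sub that by auto
    ultimately show ?thesis
      using ord by blast
  qed
  show thesis
  proof (rule that[of "g ` {..<N}" "g 0"])
    show "is_downset Q (g ` {..<N})"
      using is_downset_image_embedding[OF g(2) _ _ is_downset_chain_fork_halves(1)]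
        ord chain_sub is_downsetD(1)[OF is_downset_split_downset[of N N]] assms(3) by simp
    show "card (g ` {..<N}) = N"
      using inj_on_subset[OF g(1) chain_sub] by (simp add: card_image)
    show "g 0 \<in> g ` {..<N}" "\<forall>x\<in>g ` {..<N}. (g 0, x) \<in> snd Q"
      using mono assms(3) by auto
    show "\<forall>x\<in>g ` {..<N}. \<forall>y\<in>g ` {..<N}. (x, y) \<in> snd Q \<or> (y, x) \<in> snd Q"
      using mono by (metis imageE lessThan_iff nat_le_linear)
  qed
qed

lemma witness_chain_fork_fork_downset:
  assumes Q: "is_poset Q" and eq: "Dn (N + 1) Q = Dn (N + 1) (chain_fork N)" and "3 \<le> N"
  obtains W w u v where "is_downset Q W" "card W = N" "w \<in> W" "\<forall>x\<in>W. (w, x) \<in> snd Q"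
    "u \<in> W" "v \<in> W" "(u, v) \<notin> snd Q" "(v, u) \<notin> snd Q"
proof -
  obtain h where h: "inj_on h (split_downset N 1)" "is_downset Q (h ` split_downset N 1)"
    and ord: "\<forall>p\<in>split_downset N 1. \<forall>q\<in>split_downset N 1.
      (p, q) \<in> chain_fork_rel N \<longleftrightarrow> (h p, h q) \<in> snd Q"
    using Dn_eq_embeds_downset[OF is_poset_chain_fork eq is_downset_split_downset[of 1 N]
        card_split_downset[of 1 N]] assms(3) by auto
  have fork_sub: "{N..<2 * N} \<subseteq> split_downset N 1"
    unfolding split_downset_def by auto
  have least: "(h N, h j) \<in> snd Q" if "N \<le> j" "j < 2 * N" for j
  proof -
    have "(N, j) \<in> chain_fork_rel N"
      using that assms(3) by (auto simp: mem_chain_fork_rel)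
    moreover have "N \<in> split_downset N 1" "j \<in> split_downset N 1"
      using fork_sub that assms(3) by auto
    ultimately show ?thesis
      using ord by blast
  qed
  have "(2 * N - 2, 2 * N - 1) \<notin> chain_fork_rel N" "(2 * N - 1, 2 * N - 2) \<notin> chain_fork_rel N"
    by (auto simp: mem_chain_fork_rel)
  moreover have tops: "2 * N - 2 \<in> {N..<2 * N}" "2 * N - 1 \<in> {N..<2 * N}"
    using assms(3) by auto
  ultimately have "(h (2 * N - 2), h (2 * N - 1)) \<notin> snd Q" "(h (2 * N - 1), h (2 * N - 2)) \<notin> snd Q"
    using ord fork_sub by blast+
  moreover have "is_downset Q (h ` {N..<2 * N})"
    using is_downset_image_embedding[OF h(2) _ _ is_downset_chain_fork_halves(2)]
      ord fork_sub is_downsetD(1)[OF is_downset_split_downset[of 1 N]] assms(3) by simp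
  moreover have "card (h ` {N..<2 * N}) = N"
    using inj_on_subset[OF h(1) fork_sub] by (simp add: card_image)
  moreover have "h N \<in> h ` {N..<2 * N}" "\<forall>x\<in>h ` {N..<2 * N}. (h N, x) \<in> snd Q"
    using least assms(3) by auto
  ultimately show thesis
    using that tops by blast
qed

lemma card_witness_chain_fork:
  assumes "3 \<le> N" and Q: "is_poset Q" and eq: "Dn (N + 1) Q = Dn (N + 1) (chain_fork N)"
  shows "2 * N \<le> card (fst Q)"
proof -
  obtain L l where L: "is_downset Q L" "card L = N"
    and l: "l \<in> L" "\<forall>x\<in>L. (l, x) \<in> snd Q"
    and chain: "\<forall>x\<in>L. \<forall>y\<in>L. (x, y) \<in> snd Q \<or> (y, x) \<in> snd Q"
    using witness_chain_fork_chain_downset[OF Q eq] assms(1) by auto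
  obtain W w u v where W: "is_downset Q W" "card W = N"
    and w: "w \<in> W" "\<forall>x\<in>W. (w, x) \<in> snd Q"
    and incomparable: "u \<in> W" "v \<in> W" "(u, v) \<notin> snd Q" "(v, u) \<notin> snd Q"
    using witness_chain_fork_fork_downset[OF Q eq assms(1)] .
  have "\<not> W \<subseteq> L"
    using chain incomparable by blast
  then have "L \<inter> W = {}"
    using downsets_with_least_disjoint[OF Q L(1) W(1) _ l w]
      witness_chain_fork_no_least_downset[OF Q eq] L(2) by blast
  have sub: "L \<union> W \<subseteq> fst Q" and fin: "finite (fst Q)"
    using is_downsetD(1)[OF L(1)] is_downsetD(1)[OF W(1)] Q unfolding is_poset_def by auto
  have "2 * N = card (L \<union> W)"
    using card_Un_disjoint[of L W] \<open>L \<inter> W = {}\<close> finite_subset[OF sub fin] L(2) W(2) by simp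
  also have "\<dots> \<le> card (fst Q)"
    using card_mono[OF fin sub] .
  finally show ?thesis .
qed

theorem mainTheorem3:
  fixes c :: real
  shows "\<exists>n \<Gamma>. covtree_node n \<Gamma> \<and>
           (\<forall>Q. is_witness n \<Gamma> Q \<longrightarrow> real (card (fst Q)) > real n + real (card \<Gamma>) + c)"
proof -
  define m where "m = nat \<lceil>c\<rceil>"
  define N where "N = 2 * m + 6"
  define \<Gamma> where "\<Gamma> = Dn (N + 1) (chain_fork N)"
  have "covtree_node (N + 1) \<Gamma>"
    unfolding \<Gamma>_def by (rule covtree_node_Dn[OF is_poset_chain_fork])
  moreover have "real (card (fst Q)) > real (N + 1) + real (card \<Gamma>) + c"
    if "is_witness (N + 1) \<Gamma> Q" for Q
  proof -
    have "real (4 * m + 12) \<le> real (card (fst Q))"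
      using card_witness_chain_fork[of N Q] that unfolding is_witness_def \<Gamma>_def N_def by simp
    moreover have "real (card \<Gamma>) \<le> real (m + 4)"
      using card_Dn_chain_fork[of N] unfolding \<Gamma>_def N_def by simp
    moreover have "c \<le> real m"
      unfolding m_def by linarith
    ultimately show ?thesis
      unfolding N_def by simp
  qed
  ultimately show ?thesis
    by blast
qed

end
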